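(* If $B$ is a rank-$2$ exchange matrix (i.e. a $2\times 2$ exchange matrix) of finite type, then for any underlying ring $R$, the $\mathbf g$-vectors for $B^T$ (the set $\{\mathbf g^{B^T;t_0}_{i;t}:i\in[2],\,t\in\mathbb T_2\}$) constitute a positive $R$-basis for $B$.
   Context: **Basic conventions.** $[n]=\{1,\dots,n\}$; $[a]_+=\max(a,0)$; $\operatorname{sgn}(a)\in\{-1,0,1\}$ is the sign of $a$; $\mathbf{min}(\mathbf a,\mathbf 0)$ is the entrywise minimum with $0$. An *underlying ring* $R$ is either $\mathbb Z$ or a field with $\mathbb Q\subseteq R\subseteq\mathbb R$. An *exchange matrix* is an $n\times n$ integer matrix $B=(b_{ij})$ for which there are positive integers $d_i$ with $d_ib_{ij}=-d_jb_{ji}$ for all $i,j$; here $n=2$, so $B=\begin{bmatrix}0 & a \\ b & 0\end{bmatrix}$ with integers $a,b$, $\operatorname{sgn}(b)=-\operatorname{sgn}(a)$. An integer extended exchange matrix has rows indexed by $[n]$ forming an exchange matrix and further integer rows. For $k\in[n]$, mutation $\mu_k$ of an (extended) exchange matrix $(b_{ij})$ gives $(b'_{ij})$ with $b'_{ij}=-b_{ij}$ if $i=k$ or $j=k$, and $b'_{ij}=b_{ij}+\operatorname{sgn}(b_{kj})[b_{ik}b_{kj}]_+$ otherwise. **Finite type.** $B$ is of *finite type* if the cluster pattern with initial exchange matrix $B$ contains only finitely many distinct seeds (equivalently, in rank $2$, by the known classification, $ab\ge-3$). This depends only on $B$, so one may use the coefficient-free pattern: seeds are pairs $((x_1,\dots,x_n),B)$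 in a field $\mathbb Q(x_1,\dots,x_n)$, and mutation in direction $k$ replaces $B$ by $\mu_k(B)$ and $x_k$ by $x_k^{-1}\left(\prod_ix_i^{[b_{ik}]_+}+\prod_ix_i^{[-b_{ik}]_+}\right)$. **Mutation maps.** $\eta_k^B:\mathbb R^n\to\mathbb R^n$ sends $\mathbf a$ to $\mathbf a'$, where $a'_k=-a_k$ and, for $j\ne k$: $a'_j=a_j+a_kb_{kj}$ if $a_k\ge0$ and $b_{kj}\ge0$; $a'_j=a_j-a_kb_{kj}$ if $a_k\le0$ and $b_{kj}\le0$; $a'_j=a_j$ otherwise. For a finite sequence $\mathbf k=k_q,\dots,k_1$ in $[n]$, put $B_1=B$, $B_{i+1}=\mu_{k_i}(B_i)$ and $\eta^B_{\mathbf k}=\eta^{B_q}_{k_q}\circ\cdots\circ\eta^{B_1}_{k_1}$ (identity if $\mathbf k$ is empty). **Bases.** For $S$ finite, $\mathbf v_i\in\mathbb R^n$, $c_i\in R$, the formal expression $\sum_{i\in S}c_i\mathbf v_i$ is a *$B$-coherent linear relation with coefficients in $R$* if $\sum_{i\in S}c_i\eta^B_{\mathbf k}(\mathbf v_i)=\mathbf 0$ and $\sum_{i\in S}c_i\,\mathbf{min}(\eta^B_{\mathbf k}(\mathbf v_i),\mathbf 0)=\mathbf 0$ for every finite sequence $\mathbf k$ in $[n]$. A collection $(\mathbf b_i:i\in I)$ of vectors in $R^n$ is an *$R$-basis for $B$* if (i) for every $\mathbf a\in R^n$ there are a finite $S\subseteq I$ and $c_i\in R$ such that $\mathbf a-\sum_{i\in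 S}c_i\mathbf b_i$ is $B$-coherent; and (ii) every $B$-coherent linear relation $\sum_{i\in S}c_i\mathbf b_i$ with $S\subseteq I$ finite and $c_i\in R$ has all $c_i=0$. It is *positive* if for every $\mathbf a\in R^n$ the set $S$ and the $c_i$ in (i) can be chosen with all $c_i>0$. **$\mathbf g$-vectors.** $\mathbb T_n$ is the $n$-regular tree with edges labeled by $[n]$, each vertex incident to exactly one edge of each label; $t_0$ is a fixed vertex. For an exchange matrix $M$, let $t\mapsto\tilde M_t=(m^t_{ij})$ assign to each vertex a $2n\times n$ matrix, with $\tilde M_{t_0}$ having top $n$ rows $M$ and bottom $n$ rows the identity matrix, and $\tilde M_{t'}=\mu_k(\tilde M_t)$ when $t,t'$ are joined by an edge labeled $k$. The $\mathbf g$-vectors $\mathbf g_{\ell;t}=\mathbf g^{M;t_0}_{\ell;t}\in\mathbb Z^n$ are defined by $\mathbf g_{\ell;t_0}=\mathbf e_\ell$ (standard unit vector) and, for each edge labeled $k$ joining $t$ and $t'$: $\mathbf g_{\ell;t'}=\mathbf g_{\ell;t}$ if $\ell\neq k$, and $$\mathbf g_{k;t'}=-\mathbf g_{k;t}+\sum_{i=1}^n[m^t_{ik}]_+\mathbf g_{i;t}-\sum_{i=1}^n[m^t_{n+i,k}]_+\,\mathrm{col}(i,M),$$ where $\mathrm{col}(i,M)$ is the $i$th column of $M$ (it is known that this is well defined). Here $M=B^T$ is the transpose of $B$. *)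

theory Defs
  imports "HOL-Analysis.Analysis" "HOL-Computational_Algebra.Fraction_Field" "HOL-Computational_Algebra.Polynomial"
begin

section \<open>Exchange matrices and their mutation\<close>

definition exchange_matrix :: "int^'n^'n \<Rightarrow> bool" where
  "exchange_matrix B \<longleftrightarrow>
     (\<exists>d :: 'n \<Rightarrow> int. (\<forall>i. d i > 0) \<and> (\<forall>i j. d i * B $ i $ j = - (d j * B $ j $ i)))"

text \<open>
  The rows of an extended exchange matrix are indexed by a type \<open>'m\<close>, into which the column
  indices are embedded by a map \<open>r\<close>; the rows \<open>r i\<close> form the exchange matrix.
  We use \<open>r = id\<close> for exchange matrices and \<open>r = Inl\<close> for \<open>2n \<times> n\<close> matrices.
\<close>

definition mutate :: "('n \<Rightarrow> 'm) \<Rightarrow> 'n \<Rightarrow> int^'n^'m \<Rightarrow> int^'n^'m" where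
  "mutate r k B = (\<chi> i j.
     if i = r k \<or> j = k then - B $ i $ j
     else B $ i $ j + sgn (B $ r k $ j) * max (B $ i $ k * B $ r k $ j) 0)"

text \<open>
  A sequence \<open>k\<^sub>q, \<dots>, k\<^sub>1\<close> is the list \<open>[k\<^sub>q, \<dots>, k\<^sub>1]\<close>: the head of the list is the
  last mutation performed.
\<close>

primrec mutate_seq :: "('n \<Rightarrow> 'm) \<Rightarrow> int^'n^'m \<Rightarrow> 'n list \<Rightarrow> int^'n^'m" where
  "mutate_seq r B [] = B"
| "mutate_seq r B (k # ks) = mutate r k (mutate_seq r B ks)"

text \<open>
  The \<open>n\<close>-regular tree: a vertex is the list of edge labels on the path without backtracking
  from it to the base vertex \<open>t\<^sub>0 = []\<close>. The edges are those joining \<open>w\<close> and \<open>k # w\<close>, with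
  label \<open>k\<close>, whenever both are vertices.
\<close>

definition tree_vertices :: "'n list set" where
  "tree_vertices = {w. distinct_adj w}"

section \<open>Finite type\<close>

text \<open>
  Exponents: \<open>nat b\<close> is \<open>[b]\<^sub>+\<close> and \<open>nat (- b)\<close> is \<open>[-b]\<^sub>+\<close>.
\<close>

definition mutate_seed ::
    "'n::finite \<Rightarrow> (('f::field)^'n) \<times> (int^'n^'n) \<Rightarrow> ('f^'n) \<times> (int^'n^'n)" where
  "mutate_seed k s = (case s of (x, B) \<Rightarrow>
     ((\<chi> j. if j = k
              then inverse (x $ k) * ((\<Prod>i\<in>UNIV. (x $ i) ^ nat (B $ i $ k))
                                     + (\<Prod>i\<in>UNIV. (x $ i) ^ nat (- B $ i $ k)))
              else x $ j),
      mutate id k B))"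

primrec seed_at ::
    "(('f::field)^'n) \<times> (int^'n^'n) \<Rightarrow> 'n::finite list \<Rightarrow> ('f^'n) \<times> (int^'n^'n)" where
  "seed_at s [] = s"
| "seed_at s (k # w) = mutate_seed k (seed_at s w)"

text \<open>
  The field \<open>\<rat>(x\<^sub>1, x\<^sub>2)\<close> is the fraction field of \<open>\<rat>[x\<^sub>1][x\<^sub>2]\<close>.
\<close>

definition initial_cluster2 :: "(rat poly poly fract)^2" where
  "initial_cluster2 = vector [Fract [:[:0, 1:]:] 1, Fract [:0, 1:] 1]"

definition finite_type2 :: "int^2^2 \<Rightarrow> bool" where
  "finite_type2 B \<longleftrightarrow> finite (seed_at (initial_cluster2, B) ` tree_vertices)"

section \<open>Mutation maps\<close>

definition mutation_map :: "int^'n^'n \<Rightarrow> 'n \<Rightarrow> real^'n \<Rightarrow> real^'n" where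
  "mutation_map B k a = (\<chi> j.
     if j = k then - a $ k
     else if a $ k \<ge> 0 \<and> B $ k $ j \<ge> 0 then a $ j + a $ k * of_int (B $ k $ j)
     else if a $ k \<le> 0 \<and> B $ k $ j \<le> 0 then a $ j - a $ k * of_int (B $ k $ j)
     else a $ j)"

primrec mutation_map_seq :: "int^'n^'n \<Rightarrow> 'n list \<Rightarrow> real^'n \<Rightarrow> real^'n" where
  "mutation_map_seq B [] a = a"
| "mutation_map_seq B (k # ks) a =
     mutation_map (mutate_seq id B ks) k (mutation_map_seq B ks a)"

section \<open>Coherent relations and bases\<close>

definition underlying_ring :: "real set \<Rightarrow> bool" where
  "underlying_ring R \<longleftrightarrow>
     R = \<int> \<or> (\<rat> \<subseteq> R \<and> (\<forall>x\<in>R. \<forall>y\<in>R. x - y \<in> R \<and> x * y \<in> R \<and> x / y \<in> R))"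

definition vectors_over :: "real set \<Rightarrow> (real^'n) set" where
  "vectors_over R = {v. \<forall>i. v $ i \<in> R}"

definition min_zero :: "real^'n \<Rightarrow> real^'n" where
  "min_zero v = (\<chi> i. min (v $ i) 0)"

text \<open>
  The formal expression \<open>\<Sum>i\<in>S. c\<^sub>i v\<^sub>i\<close> is given by the index set and the two families.
\<close>

definition coherent_relation ::
    "real set \<Rightarrow> int^'n^'n \<Rightarrow> 'i set \<Rightarrow> ('i \<Rightarrow> real) \<Rightarrow> ('i \<Rightarrow> real^'n) \<Rightarrow> bool" where
  "coherent_relation R B S c v \<longleftrightarrow>
     finite S \<and> (\<forall>i\<in>S. c i \<in> R) \<and>
     (\<forall>ks. (\<Sum>i\<in>S. c i *\<^sub>R mutation_map_seq B ks (v i)) = 0 \<and>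
           (\<Sum>i\<in>S. c i *\<^sub>R min_zero (mutation_map_seq B ks (v i))) = 0)"

text \<open>
  The formal expression \<open>a - \<Sum>i\<in>S. c\<^sub>i b\<^sub>i\<close> is coherent; the index \<open>None\<close> stands for the
  term \<open>a\<close>.
\<close>

definition coherently_expressed ::
    "real set \<Rightarrow> int^'n^'n \<Rightarrow> real^'n \<Rightarrow> 'i set \<Rightarrow> ('i \<Rightarrow> real) \<Rightarrow> ('i \<Rightarrow> real^'n) \<Rightarrow> bool" where
  "coherently_expressed R B a S c b \<longleftrightarrow>
     coherent_relation R B (insert None (Some ` S))
       (case_option 1 (\<lambda>i. - c i)) (case_option a b)"

definition basis_for ::
    "real set \<Rightarrow> int^'n^'n \<Rightarrow> 'i set \<Rightarrow> ('i \<Rightarrow> real^'n) \<Rightarrow> bool" where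
  "basis_for R B I b \<longleftrightarrow>
     (\<forall>i\<in>I. b i \<in> vectors_over R) \<and>
     (\<forall>a\<in>vectors_over R. \<exists>S c. finite S \<and> S \<subseteq> I \<and> (\<forall>i\<in>S. c i \<in> R) \<and>
        coherently_expressed R B a S c b) \<and>
     (\<forall>S c. finite S \<longrightarrow> S \<subseteq> I \<longrightarrow> (\<forall>i\<in>S. c i \<in> R) \<longrightarrow>
        coherent_relation R B S c b \<longrightarrow> (\<forall>i\<in>S. c i = 0))"

definition positive_basis_for ::
    "real set \<Rightarrow> int^'n^'n \<Rightarrow> 'i set \<Rightarrow> ('i \<Rightarrow> real^'n) \<Rightarrow> bool" where
  "positive_basis_for R B I b \<longleftrightarrow>
     basis_for R B I b \<and>
     (\<forall>a\<in>vectors_over R. \<exists>S c. finite S \<and> S \<subseteq> I \<and> (\<forall>i\<in>S. c i \<in> R \<and> c i > 0) \<and>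
        coherently_expressed R B a S c b)"

section \<open>g-vectors\<close>

definition principal_extension :: "int^'n^'n \<Rightarrow> int^'n^('n + 'n)" where
  "principal_extension M = (\<chi> i j. case i of Inl i' \<Rightarrow> M $ i' $ j | Inr i' \<Rightarrow> if i' = j then 1 else 0)"

definition principal_matrix_at :: "int^'n^'n \<Rightarrow> 'n list \<Rightarrow> int^'n^('n::finite + 'n)" where
  "principal_matrix_at M w = mutate_seq Inl (principal_extension M) w"

text \<open>
  The recursion along an edge is used in the direction leading away from the base vertex; the
  relation for the opposite direction is then known to hold too.
\<close>

primrec g_vector :: "int^'n^'n \<Rightarrow> 'n::finite list \<Rightarrow> 'n \<Rightarrow> int^'n" where
  "g_vector M [] = (\<lambda>l. axis l 1)"
| "g_vector M (k # w) = (\<lambda>l.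
     if l \<noteq> k then g_vector M w l
     else - g_vector M w k
          + (\<Sum>i\<in>UNIV. max (principal_matrix_at M w $ Inl i $ k) 0 *s g_vector M w i)
          - (\<Sum>i\<in>UNIV. max (principal_matrix_at M w $ Inr i $ k) 0 *s column i M))"

definition g_vectors :: "int^'n^'n \<Rightarrow> (int^'n::finite) set" where
  "g_vectors M = {g_vector M w l | w l. w \<in> tree_vertices}"

definition real_of_int_vec :: "int^'n \<Rightarrow> real^'n" where
  "real_of_int_vec v = (\<chi> i. of_int (v $ i))"

end

theory Submission imports Defs
begin

text \<open>
  Write the exchange matrix as \<open>s\<close> times the matrix with off-diagonal entries \<open>\<alpha>\<close> and \<open>-\<beta>\<close>,
  where \<open>s = \<plusminus>1\<close> and \<open>\<alpha>, \<beta> \<ge> 0\<close>. In rank 2 a mutation only changes the sign \<open>s\<close>.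

  Finite type forces \<open>\<alpha> \<beta> \<le> 3\<close>. Indeed, along an alternating sequence of mutations the degrees
  in \<open>x\<^sub>2\<close> of the cluster variables start with \<open>0, 1\<close> and satisfy \<open>D\<^bsub>n+2\<^esub> = c D\<^bsub>n+1\<^esub> - D\<^sub>n\<close>, where
  \<open>c\<close> alternates between \<open>\<beta>\<close> and \<open>\<alpha>\<close>. For \<open>\<alpha> \<beta> \<ge> 4\<close> these degrees are unbounded
  (\<open>finite_type_product_bound\<close>). This leaves six pairs \<open>(\<alpha>, \<beta>)\<close>.

  For these pairs let \<open>v\<^sub>0 = e\<^sub>2\<close>, \<open>v\<^sub>1 = e\<^sub>1\<close> and continue by the same recurrence. With the
  Coxeter number \<open>h\<close> one has \<open>v\<^sub>h = -e\<^sub>2\<close> and \<open>v\<^bsub>h+1\<^esub> = -e\<^sub>1\<close>, and \<open>v\<^sub>0, \<dots>, v\<^bsub>h+1\<^esub>\<close> are, in cyclic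
  order, the rays of a complete unimodular fan. The mutation map in direction 1 sends \<open>s v\<^sub>m\<close>
  to \<open>-s v\<^bsub>-2-m\<^esub>\<close> and the one in direction 2 sends it to \<open>-s v\<^bsub>-m\<^esub>\<close>, with indices modulo \<open>h + 2\<close>
  (\<open>mutation_map_ray\<close>). So the mutation maps act on the \<open>(h + 2)\<close>-gon of rays by reflections,
  and both halves of the basis property follow from this.

  Existence and positivity: neighbouring rays stay neighbouring under all mutation maps, and
  neighbouring rays lie in a common closed orthant. Hence all mutation maps, and the entrywise
  minimum after them, are linear on the cone of two neighbours, and every relation that writes
  a vector of this cone as a nonnegative combination of the two rays is coherent. By
  unimodularity the coefficients lie in the ring (\<open>rays_span_positively\<close>).

  Independence: only the ray \<open>s v\<^sub>0\<close> has a second coordinate of sign \<open>s\<close>, and only \<open>s v\<^bsub>h+1\<^esub>\<close> has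
  a first coordinate of sign \<open>-s\<close>. A coherent relation stays valid when each vector is
  replaced by the positive, or the negative, part of one coordinate, so the coefficients of
  these two rays vanish. The reflections carry any ray to one of these two, so every
  coefficient vanishes (\<open>rays_independent\<close>).

  Finally, the matrices and \<open>g\<close>-vectors along the two alternating paths from the base vertex
  are periodic, and computing one period shows that the \<open>g\<close>-vectors are the rays
  (\<open>g_vectors_rays\<close>).
\<close>

section \<open>Mutation maps and coherent relations\<close>

text \<open>
  The two cases of the definition merge into a positive and a negative part, since both
  formulas agree where they overlap. In this form linearity on orthants is visible.
\<close>

lemma mutation_map_nth:
  "mutation_map B k a $ j =
     (if j = k then - a $ k
      else if B $ k $ j \<ge> 0 then a $ j + max (a $ k) 0 * of_int (B $ k $ j)
      else a $ j - min (a $ k) 0 * of_int (B $ k $ j))"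
  by (auto simp: mutation_map_def max_def min_def)

lemma mutation_map_minus: "mutation_map (- B) k (- a) = - mutation_map B k a"
  by (auto simp: mutation_map_nth vec_eq_iff max_def min_def)

text \<open>
  Mutation negates row \<open>k\<close> and the mutation map negates coordinate \<open>k\<close>, so the correction term
  added to coordinate \<open>j\<close> the first time is subtracted the second time.
\<close>

lemma mutation_map_involution: "mutation_map (mutate id k B) k (mutation_map B k a) = a"
  by (auto simp: mutation_map_nth mutate_def vec_eq_iff max_def min_def)

lemma inj_mutation_map_seq: "inj (mutation_map_seq B ks)"
proof (induction ks)
  case (Cons k ks)
  have "inj (mutation_map (mutate_seq id B ks) k)"
    by (rule inj_on_inverseI, rule mutation_map_involution)
  from inj_compose[OF this Cons] show ?case
    by (simp add: o_def)
qed (simp add: inj_def)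

lemma mutate_seq_append: "mutate_seq r B (ks @ js) = mutate_seq r (mutate_seq r B js) ks"
  by (induction ks) auto

lemma mutation_map_seq_append:
  "mutation_map_seq B (ks @ js) a = mutation_map_seq (mutate_seq id B js) ks (mutation_map_seq B js a)"
proof (induction ks)
  case (Cons k ks)
  show ?case
    unfolding append_Cons mutation_map_seq.simps Cons mutate_seq_append ..
qed simp

definition same_orthant :: "real^'n \<Rightarrow> real^'n \<Rightarrow> bool" where
  "same_orthant u w \<longleftrightarrow> (\<forall>i. (0 \<le> u $ i \<and> 0 \<le> w $ i) \<or> (u $ i \<le> 0 \<and> w $ i \<le> 0))"

lemma same_orthant_commute: "same_orthant u w \<longleftrightarrow> same_orthant w u"
  by (auto simp: same_orthant_def)

lemma max_min_zero_linear_same_sign: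
  fixes x y c d :: real
  assumes "(0 \<le> x \<and> 0 \<le> y) \<or> (x \<le> 0 \<and> y \<le> 0)" "0 \<le> c" "0 \<le> d"
  shows "max (c * x + d * y) 0 = c * max x 0 + d * max y 0"
    and "min (c * x + d * y) 0 = c * min x 0 + d * min y 0"
proof -
  from assms have "(0 \<le> c * x \<and> 0 \<le> d * y \<and> 0 \<le> x \<and> 0 \<le> y) \<or> (c * x \<le> 0 \<and> d * y \<le> 0 \<and> x \<le> 0 \<and> y \<le> 0)"
    by (auto simp: mult_nonneg_nonpos)
  then show "max (c * x + d * y) 0 = c * max x 0 + d * max y 0"
    and "min (c * x + d * y) 0 = c * min x 0 + d * min y 0"
    by (auto simp: max_def min_def)
qed

lemma mutation_map_cone:
  assumes "same_orthant u w" "0 \<le> c" "0 \<le> d"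
  shows "mutation_map B k (c *\<^sub>R u + d *\<^sub>R w) = c *\<^sub>R mutation_map B k u + d *\<^sub>R mutation_map B k w"
proof -
  note linear = max_min_zero_linear_same_sign[OF assms(1)[unfolded same_orthant_def, rule_format, of k] assms(2,3)]
  show ?thesis
    by (simp add: vec_eq_iff mutation_map_nth linear algebra_simps)
qed

lemma min_zero_cone:
  assumes "same_orthant u w" "0 \<le> c" "0 \<le> d"
  shows "min_zero (c *\<^sub>R u + d *\<^sub>R w) = c *\<^sub>R min_zero u + d *\<^sub>R min_zero w"
  using assms by (simp add: vec_eq_iff min_zero_def same_orthant_def max_min_zero_linear_same_sign)

text \<open>
  By induction, if the two images stay in common orthants, then each single mutation map is
  linear on the image cone.
\<close>

lemma mutation_map_seq_cone:
  assumes "\<And>ks. same_orthant (mutation_map_seq B ks u) (mutation_map_seq B ks w)" "0 \<le> c" "0 \<le> d"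
  shows "mutation_map_seq B ks (c *\<^sub>R u + d *\<^sub>R w)
       = c *\<^sub>R mutation_map_seq B ks u + d *\<^sub>R mutation_map_seq B ks w"
  by (induction ks) (simp_all add: mutation_map_cone assms)

lemma underlying_ring_closed:
  assumes "underlying_ring R"
  shows "\<int> \<subseteq> R" "x \<in> R \<Longrightarrow> y \<in> R \<Longrightarrow> x - y \<in> R" "x \<in> R \<Longrightarrow> y \<in> R \<Longrightarrow> x * y \<in> R"
  using assms Ints_subset_Rats by (auto simp: underlying_ring_def)

lemma coherently_expressed_iff:
  assumes "finite S"
  shows "coherently_expressed R B a S c b \<longleftrightarrow>
     1 \<in> R \<and> (\<forall>i\<in>S. - c i \<in> R) \<and>
     (\<forall>ks. mutation_map_seq B ks a = (\<Sum>i\<in>S. c i *\<^sub>R mutation_map_seq B ks (b i)) \<and>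
           min_zero (mutation_map_seq B ks a) = (\<Sum>i\<in>S. c i *\<^sub>R min_zero (mutation_map_seq B ks (b i))))"
proof -
  have "None \<notin> Some ` S" by auto
  then show ?thesis
    using assms
    by (simp add: coherently_expressed_def coherent_relation_def sum.reindex o_def sum_negf)
qed

text \<open>
  The index set consists only of those \<open>i\<close>, \<open>j\<close> with nonzero coefficient, because positivity
  asks for strictly positive coefficients.
\<close>

lemma coherently_expressed_cone:
  assumes R: "underlying_ring R"
    and orth: "\<And>ks. same_orthant (mutation_map_seq B ks (f i)) (mutation_map_seq B ks (f j))"
    and a: "a = c *\<^sub>R f i + d *\<^sub>R f j" and cd: "0 \<le> c" "0 \<le> d" "c \<in> R" "d \<in> R"
    and ij: "i \<in> I" "j \<in> I" "i \<noteq> j"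
  shows "\<exists>S c. finite S \<and> S \<subseteq> I \<and> (\<forall>i\<in>S. c i \<in> R \<and> c i > 0) \<and> coherently_expressed R B a S c f"
proof -
  define e where "e x = (if x = i then c else d)" for x
  define S where "S = {x \<in> {i, j}. e x \<noteq> 0}"
  have sums: "(\<Sum>x\<in>S. e x *\<^sub>R g x) = c *\<^sub>R g i + d *\<^sub>R g j" for g :: "'b \<Rightarrow> real^'a"
  proof -
    have "(\<Sum>x\<in>S. e x *\<^sub>R g x) = (\<Sum>x\<in>{i, j}. e x *\<^sub>R g x)"
      by (rule sum.mono_neutral_left) (auto simp: S_def)
    then show ?thesis using ij by (simp add: e_def)
  qed
  have "finite S" by (simp add: S_def)
  have "0 \<in> R" "1 \<in> R" using underlying_ring_closed(1)[OF R] by auto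
  moreover have "- e x \<in> R" for x
    using underlying_ring_closed(2)[OF R \<open>0 \<in> R\<close>, of "e x"] cd by (simp add: e_def)
  ultimately have "coherently_expressed R B a S e f"
    using \<open>finite S\<close> by (simp add: coherently_expressed_iff sums a mutation_map_seq_cone orth cd min_zero_cone)
  moreover have "S \<subseteq> I" "\<forall>x\<in>S. e x \<in> R \<and> e x > 0"
    using ij cd by (auto simp: S_def e_def)
  ultimately show ?thesis using \<open>finite S\<close> by blast
qed

text \<open>
  A coherent relation holds for the images of the vectors and for their negative parts, hence
  also for the difference of the two, which is the positive part. The sign \<open>s\<close> selects the
  part.
\<close>

lemma coherent_relation_halfspace:
  assumes "coherent_relation R B S c b" "\<bar>s\<bar> = 1"
  shows "(\<Sum>i\<in>S. c i * max (s * mutation_map_seq B ks (b i) $ j) 0) = 0"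
proof -
  let ?u = "\<lambda>i. mutation_map_seq B ks (b i)"
  have "(\<Sum>i\<in>S. c i *\<^sub>R ?u i) $ j = 0" "(\<Sum>i\<in>S. c i *\<^sub>R min_zero (?u i)) $ j = 0"
    using assms by (simp_all add: coherent_relation_def)
  then have z: "(\<Sum>i\<in>S. c i * ?u i $ j) = 0" "(\<Sum>i\<in>S. c i * min (?u i $ j) 0) = 0"
    by (simp_all add: min_zero_def)
  have *: "c i * max (s * ?u i $ j) 0 = (if s = 1 then c i * ?u i $ j - c i * min (?u i $ j) 0 else - (c i * min (?u i $ j) 0))" for i
    using assms(2) by (auto simp: max_def min_def abs_if split: if_splits)
  show ?thesis
    unfolding * using z by (cases "s = 1") (simp_all add: sum_subtractf sum_negf)
qed

text \<open>
  If a half-space contains only one of the image vectors in its interior, the relation of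
  positive parts reduces to a single term. Injectivity of the mutation maps ensures that no
  second index has the same image.
\<close>

lemma coherent_relation_coeff_zero:
  assumes rel: "coherent_relation R B S c b" and s: "\<bar>s\<bar> = 1" and inj: "inj_on b S" and i: "i \<in> S"
    and pos: "s * mutation_map_seq B ks (b i) $ j > 0"
    and others: "\<And>i'. i' \<in> S \<Longrightarrow> mutation_map_seq B ks (b i') \<noteq> mutation_map_seq B ks (b i)
        \<Longrightarrow> s * mutation_map_seq B ks (b i') $ j \<le> 0"
  shows "c i = 0"
proof -
  let ?f = "\<lambda>i. c i * max (s * mutation_map_seq B ks (b i) $ j) 0"
  have "finite S" using rel by (simp add: coherent_relation_def)
  have "?f i' = 0" if "i' \<in> S - {i}" for i'
  proof -
    have "b i' \<noteq> b i" using that inj i by (auto dest: inj_onD)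
    then have "mutation_map_seq B ks (b i') \<noteq> mutation_map_seq B ks (b i)"
      using inj_mutation_map_seq by (metis injD)
    with others that show ?thesis by (simp add: max_def)
  qed
  then have "sum ?f S = ?f i"
    using \<open>finite S\<close> i by (simp add: sum.remove sum.neutral)
  with coherent_relation_halfspace[OF rel s, of ks j] have "?f i = 0"
    by simp
  moreover have "max (s * mutation_map_seq B ks (b i) $ j) 0 \<noteq> 0"
    using pos by linarith
  ultimately show ?thesis
    by (metis mult_eq_0_iff)
qed

section \<open>Alternating mutation sequences in rank two\<close>

text \<open>
  In the index type \<open>2\<close>, arithmetic is modulo 2, so \<open>k + 1\<close> is the index other than \<open>k\<close>.
\<close>

primrec alternating :: "2 \<Rightarrow> nat \<Rightarrow> 2 list" where
  "alternating k 0 = []"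
| "alternating k (Suc n) = (if even n then k else k + 1) # alternating k n"

lemma two_add_one [simp]: "(2::2) + 1 = 1" by simp

lemma one_neq_two: "(1::2) \<noteq> 2" "(2::2) \<noteq> 1" by simp_all

lemma other_index: "(i :: 2) \<noteq> j \<longleftrightarrow> i = j + 1"
  using exhaust_2[of i] exhaust_2[of j]
  by (elim disjE) (simp_all only: two_add_one one_neq_two one_add_one simp_thms)

lemma index_rank2 [simp]: "k + 1 + 1 = k" "k + 1 \<noteq> k" "k \<noteq> k + 1" for k :: 2
  using exhaust_2[of k] by (metis two_add_one one_neq_two one_add_one)+

text \<open>
  The tree \<open>T\<^sub>2\<close> is a path, infinite in both directions; \<open>k\<close> selects the direction.
\<close>

lemma tree_vertices_rank2: "tree_vertices = {alternating k n | k n. True}"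
proof -
  have "\<exists>k n. w = alternating k n" if "distinct_adj w" for w
    using that
  proof (induction w)
    case Nil
    then show ?case by (metis alternating.simps(1))
  next
    case (Cons a w)
    then obtain k n where w: "w = alternating k n"
      by (auto simp: distinct_adj_Cons)
    show ?case
    proof (cases n)
      case 0
      then have "a # w = alternating a 1" by (simp add: w)
      then show ?thesis by blast
    next
      case (Suc m)
      with Cons.prems w have "a = (if even m then k else k + 1) + 1"
        by (subst other_index[symmetric]) simp
      then have "a # w = alternating k (Suc n)"
        by (simp add: w Suc split: if_splits)
      then show ?thesis by blast
    qed
  qed
  moreover have "distinct_adj (alternating k n)" for k n
  proof (induction n)
    case (Suc n)
    then show ?case by (cases n) (auto simp: distinct_adj_Cons)
  qed simp
  ultimately show ?thesis by (auto simp: tree_vertices_def)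
qed

definition rank2_matrix :: "int \<Rightarrow> int \<Rightarrow> int \<Rightarrow> int^2^2" where
  "rank2_matrix s \<alpha> \<beta> = vector [vector [0, s * \<alpha>], vector [- s * \<beta>, 0]]"

lemma rank2_matrix_nth [simp]:
  "rank2_matrix s \<alpha> \<beta> $ 1 $ 1 = 0" "rank2_matrix s \<alpha> \<beta> $ 1 $ 2 = s * \<alpha>"
  "rank2_matrix s \<alpha> \<beta> $ 2 $ 1 = - s * \<beta>" "rank2_matrix s \<alpha> \<beta> $ 2 $ 2 = 0"
  by (simp_all add: rank2_matrix_def)

lemma exchange_matrix_rank2:
  assumes "exchange_matrix B"
  obtains s \<alpha> \<beta> where "B = rank2_matrix s \<alpha> \<beta>" "\<bar>s\<bar> = 1" "0 \<le> \<alpha>" "0 \<le> \<beta>" "\<alpha> = 0 \<longleftrightarrow> \<beta> = 0"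
proof -
  obtain d where d: "\<And>i. d i > 0" and skew: "\<And>i j. d i * B $ i $ j = - (d j * B $ j $ i)"
    using assms by (auto simp: exchange_matrix_def)
  have diag: "B $ i $ i = 0" for i
    using skew[of i i] d[of i] by simp
  have off: "d 1 * B $ 1 $ 2 = - (d 2 * B $ 2 $ 1)" by (rule skew)
  define s where "s = (if B $ 1 $ 2 < 0 then -1 else 1 :: int)"
  have "0 \<le> - s * B $ 2 $ 1" "B $ 1 $ 2 = 0 \<longleftrightarrow> B $ 2 $ 1 = 0"
    using off d[of 1] d[of 2]
    by (auto simp: s_def) (smt (verit) mult_pos_neg mult_pos_pos mult_nonneg_nonneg zero_less_mult_iff)+
  then show ?thesis
    by (intro that[of s "s * B $ 1 $ 2" "- s * B $ 2 $ 1"])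
      (auto simp: s_def vec_eq_iff forall_2 diag)
qed

text \<open>
  The entry opposite to the mutated row and column is on the diagonal. It stays zero, because
  its correction is up to sign the positive part of \<open>- s\<^sup>2 \<alpha> \<beta> \<le> 0\<close>.
\<close>

lemma mutate_rank2_matrix:
  assumes "0 \<le> \<alpha>" "0 \<le> \<beta>"
  shows "mutate id k (rank2_matrix s \<alpha> \<beta>) = rank2_matrix (- s) \<alpha> \<beta>"
proof -
  have "s * \<alpha> * (s * \<beta>) \<ge> 0" "s * \<beta> * (s * \<alpha>) \<ge> 0"
    using assms mult_nonneg_nonneg[of "s * s" "\<alpha> * \<beta>"] by (simp_all add: mult_ac)
  then have "max (- (s * \<alpha> * (s * \<beta>))) 0 = 0" "max (- (s * \<beta> * (s * \<alpha>))) 0 = 0"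
    by auto
  then show ?thesis
    using exhaust_2[of k] by (auto simp: mutate_def vec_eq_iff forall_2)
qed

section \<open>Degrees of cluster variables in infinite type\<close>

text \<open>
  Solutions of a recurrence with two-periodic coefficient \<open>p, q, p, \<dots>\<close> and initial values
  \<open>x, y\<close>. It governs the degrees of cluster variables as well as the rays of the fan below.
\<close>

fun alternating_rec :: "int \<Rightarrow> int \<Rightarrow> int \<Rightarrow> int \<Rightarrow> nat \<Rightarrow> int" where
  "alternating_rec p q x y 0 = x"
| "alternating_rec p q x y (Suc 0) = y"
| "alternating_rec p q x y (Suc (Suc n)) = (if even n then p else q) * alternating_rec p q x y (Suc n) - alternating_rec p q x y n"

lemma alternating_rec_shift: "alternating_rec p q x y (Suc n) = alternating_rec q p y (p * y - x) n"
  by (induction n rule: induct_nat_012) simp_all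

text \<open>
  As code equations, these evaluate a term with linearly many steps; the three-term recurrence
  itself branches exponentially.
\<close>

declare alternating_rec_shift [code] alternating_rec.simps(1) [code]

text \<open>
  The degree valuation of the field of fractions, as a relation. Over \<open>\<rat>[x\<^sub>1][x\<^sub>2]\<close> it is the
  degree in \<open>x\<^sub>2\<close>.
\<close>

definition has_degree :: "'a::idom poly fract \<Rightarrow> int \<Rightarrow> bool" where
  "has_degree f d \<longleftrightarrow> (\<exists>p q. p \<noteq> 0 \<and> q \<noteq> 0 \<and> f = Fract p q \<and> d = int (degree p) - int (degree q))"

lemma has_degree_unique:
  assumes "has_degree f d" "has_degree f e"
  shows "d = e"
proof -
  from assms(1) obtain p q where p: "p \<noteq> 0" "q \<noteq> 0" "f = Fract p q"
    "d = int (degree p) - int (degree q)"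
    by (auto simp: has_degree_def)
  from assms(2) obtain p' q' where p': "p' \<noteq> 0" "q' \<noteq> 0" "f = Fract p' q'"
    "e = int (degree p') - int (degree q')"
    by (auto simp: has_degree_def)
  from p p' have "Fract p q = Fract p' q'" by simp
  then have "p * q' = p' * q" using p(2) p'(2) by (simp add: eq_fract)
  then have "degree p + degree q' = degree p' + degree q"
    using p p' by (metis degree_mult_eq)
  with p p' show ?thesis by simp
qed

lemma has_degree_mult: "has_degree f d \<Longrightarrow> has_degree g e \<Longrightarrow> has_degree (f * g) (d + e)"
  unfolding has_degree_def
  by (elim exE conjE, rule_tac x = "p * pa" in exI, rule_tac x = "q * qa" in exI)
     (simp add: degree_mult_eq)

lemma has_degree_inverse: "has_degree f d \<Longrightarrow> has_degree (inverse f) (- d)"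
  unfolding has_degree_def by (elim exE conjE, rule_tac x = q in exI, rule_tac x = p in exI) simp

lemma has_degree_one: "has_degree 1 0"
  unfolding has_degree_def by (rule exI[of _ 1], rule exI[of _ 1]) (simp add: One_fract_def)

lemma has_degree_power: "has_degree f d \<Longrightarrow> has_degree (f ^ n) (int n * d)"
proof (induction n)
  case (Suc n)
  then show ?case using has_degree_mult[of f d "f ^ n" "int n * d"] by (simp add: algebra_simps)
qed (simp add: has_degree_one)

lemma has_degree_add_one:
  assumes "has_degree f d" "d > 0"
  shows "has_degree (f + 1) d"
proof -
  from assms obtain p q where *: "p \<noteq> 0" "q \<noteq> 0" "f = Fract p q" "d = int (degree p) - int (degree q)"
    unfolding has_degree_def by blast
  with assms(2) have "degree q < degree p" by simp
  then have "degree (p + q) = degree p" by (rule degree_add_eq_left)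
  moreover from this \<open>degree q < degree p\<close> have "p + q \<noteq> 0" by auto
  moreover have "f + 1 = Fract (p + q) q" using * by (simp add: One_fract_def)
  ultimately show ?thesis
    unfolding has_degree_def using * by (intro exI[of _ "p + q"] exI[of _ q]) simp
qed

lemma mutate_seed_rank2_matrix:
  assumes "\<bar>s\<bar> = 1" "0 \<le> \<alpha>" "0 \<le> \<beta>"
  shows "mutate_seed 1 (x, rank2_matrix s \<alpha> \<beta>) =
           (\<chi> j. if j = 1 then inverse (x $ 1) * ((x $ 2) ^ nat \<beta> + 1) else x $ j, rank2_matrix (- s) \<alpha> \<beta>)"
    and "mutate_seed 2 (x, rank2_matrix s \<alpha> \<beta>) =
           (\<chi> j. if j = 2 then inverse (x $ 2) * ((x $ 1) ^ nat \<alpha> + 1) else x $ j, rank2_matrix (- s) \<alpha> \<beta>)"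
  using assms by (auto simp: mutate_seed_def mutate_rank2_matrix vec_eq_iff UNIV_2 abs_if add.commute split: if_splits)

text \<open>
  Two steps of the recurrence give \<open>D\<^bsub>n+4\<^esub> = (p q - 2) D\<^bsub>n+2\<^esub> - D\<^sub>n\<close>. For \<open>p q \<ge> 4\<close> this makes the
  terms with indices of one parity convex, so their first positive increment persists.
\<close>

lemma alternating_rec_growth:
  assumes "0 < p" "0 < q" "4 \<le> p * q"
  shows "alternating_rec p q 0 1 n + 1 \<le> alternating_rec p q 0 1 (Suc (Suc n)) \<and> 0 \<le> alternating_rec p q 0 1 n"
proof (induction n rule: induct_nat_012)
  case 0
  show ?case using assms by simp
next
  case 1
  show ?case using assms by (simp add: mult.commute)
next
  case (ge2 n)
  let ?D = "alternating_rec p q 0 1"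
  have "?D (Suc (Suc (Suc (Suc n)))) = (p * q - 2) * ?D (Suc (Suc n)) - ?D n"
    by (simp add: algebra_simps)
  moreover have "2 * ?D (Suc (Suc n)) \<le> (p * q - 2) * ?D (Suc (Suc n))"
    using ge2 assms by (intro mult_right_mono) auto
  ultimately show ?case using ge2 by linarith
qed

text \<open>
  Exchanging the variable of degree \<open>D\<^sub>n\<close> replaces it by \<open>(y\<^sup>c + 1) / x\<close>, where \<open>y\<close> is the other
  variable. As \<open>y\<close> has positive degree, the summand 1 does not matter, and the new degree is
  \<open>c D\<^bsub>n+1\<^esub> - D\<^sub>n\<close>.
\<close>

lemma seed_degrees:
  assumes "0 < \<alpha>" "0 < \<beta>" "4 \<le> \<alpha> * \<beta>" "\<bar>s\<bar> = 1"
  shows "\<exists>x t. seed_at (initial_cluster2, rank2_matrix s \<alpha> \<beta>) (alternating 1 n) = (x, rank2_matrix t \<alpha> \<beta>) \<and> \<bar>t\<bar> = 1 \<and>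
     has_degree (x $ (if even n then 1 else 2)) (alternating_rec \<beta> \<alpha> 0 1 n) \<and>
     has_degree (x $ (if even n then 2 else 1)) (alternating_rec \<beta> \<alpha> 0 1 (Suc n))"
proof (induction n)
  case 0
  have "has_degree (Fract [:[:0, 1:]:] 1 :: rat poly poly fract) 0"
    unfolding has_degree_def by (rule exI[of _ "[:[:0, 1:]:]"], rule exI[of _ 1]) simp
  moreover have "has_degree (Fract [:0, 1:] 1 :: rat poly poly fract) 1"
    unfolding has_degree_def by (rule exI[of _ "[:0, 1:]"], rule exI[of _ 1]) simp
  ultimately show ?case
    using assms by (intro exI[of _ initial_cluster2] exI[of _ s]) (simp add: initial_cluster2_def)
next
  case (Suc n)
  let ?D = "alternating_rec \<beta> \<alpha> 0 1" and ?c = "if even n then \<beta> else \<alpha>"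
  define i j :: 2 where "i = (if even n then 1 else 2)" and "j = (if even n then 2 else 1)"
  from Suc obtain x t where x: "seed_at (initial_cluster2, rank2_matrix s \<alpha> \<beta>) (alternating 1 n) = (x, rank2_matrix t \<alpha> \<beta>)"
    and t: "\<bar>t\<bar> = 1" and D: "has_degree (x $ i) (?D n)" "has_degree (x $ j) (?D (Suc n))"
    by (auto simp: i_def j_def)
  define y where "y = inverse (x $ i) * ((x $ j) ^ nat ?c + 1)"
  have "0 < ?D (Suc n)"
  proof (cases n)
    case (Suc m)
    then show ?thesis using alternating_rec_growth[of \<beta> \<alpha> m] assms by (simp add: mult.commute)
  qed simp
  then have "has_degree y (?D (Suc (Suc n)))"
    using has_degree_mult[OF has_degree_inverse[OF D(1)]
        has_degree_add_one[OF has_degree_power[OF D(2), of "nat ?c"]]] assms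
    by (auto simp: y_def)
  moreover have "seed_at (initial_cluster2, rank2_matrix s \<alpha> \<beta>) (alternating 1 (Suc n))
      = (\<chi> l. if l = i then y else x $ l, rank2_matrix (- t) \<alpha> \<beta>)"
    using x t assms mutate_seed_rank2_matrix[of t \<alpha> \<beta> x]
    by (cases "even n") (simp_all add: y_def i_def j_def cong: if_cong)
  ultimately show ?case using D t by (auto simp: i_def j_def)
qed

lemma finite_type_product_bound:
  assumes "finite_type2 (rank2_matrix s \<alpha> \<beta>)" "0 < \<alpha>" "0 < \<beta>" "\<bar>s\<bar> = 1"
  shows "\<alpha> * \<beta> \<le> 3"
proof (rule ccontr)
  assume "\<not> \<alpha> * \<beta> \<le> 3"
  then have big: "4 \<le> \<alpha> * \<beta>" by simp
  let ?D = "alternating_rec \<beta> \<alpha> 0 1"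
  let ?seed = "\<lambda>n. seed_at (initial_cluster2, rank2_matrix s \<alpha> \<beta>) (alternating 1 (2 * n))"
  have deg: "has_degree (fst (?seed n) $ 1) (?D (2 * n))" for n
    using seed_degrees[OF assms(2,3) big assms(4), of "2 * n"] by auto
  have "strict_mono (\<lambda>n. ?D (2 * n))"
  proof (rule strict_mono_Suc_iff[THEN iffD2], rule allI)
    fix n show "?D (2 * n) < ?D (2 * Suc n)"
      using alternating_rec_growth[of \<beta> \<alpha> "2 * n"] assms big by (simp add: mult.commute)
  qed
  then have "inj (\<lambda>n. ?D (2 * n))" by (rule strict_mono_imp_inj_on)
  then have "inj ?seed" using deg has_degree_unique by (metis (no_types, lifting) injD injI)
  then have "infinite (range ?seed)" using finite_imageD by blast
  moreover have "range ?seed \<subseteq> seed_at (initial_cluster2, rank2_matrix s \<alpha> \<beta>) ` tree_vertices"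
    by (auto simp: tree_vertices_rank2)
  ultimately show False
    using assms(1) finite_subset by (auto simp: finite_type2_def)
qed

text \<open>
  The pairs of the finite Cartan types \<open>A\<^sub>1 \<times> A\<^sub>1\<close>, \<open>A\<^sub>2\<close>, \<open>B\<^sub>2\<close> and \<open>G\<^sub>2\<close>.
\<close>

definition finite_type_pairs :: "(int \<times> int) set" where
  "finite_type_pairs = {(0, 0), (1, 1), (1, 2), (2, 1), (1, 3), (3, 1)}"

lemma finite_type_rank2:
  assumes "finite_type2 (rank2_matrix s \<alpha> \<beta>)" "\<bar>s\<bar> = 1" "0 \<le> \<alpha>" "0 \<le> \<beta>" "\<alpha> = 0 \<longleftrightarrow> \<beta> = 0"
  shows "(\<alpha>, \<beta>) \<in> finite_type_pairs"
proof (cases "\<alpha> = 0")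
  case False
  then have pos: "1 \<le> \<alpha>" "1 \<le> \<beta>" using assms by auto
  then have bound: "\<alpha> * \<beta> \<le> 3" using finite_type_product_bound assms by auto
  have "\<alpha> \<le> \<alpha> * \<beta>" "\<beta> \<le> \<alpha> * \<beta>" using pos by auto
  with bound have "\<alpha> \<le> 3" "\<beta> \<le> 3" by linarith+
  with pos have "\<alpha> \<in> {1, 2, 3}" "\<beta> \<in> {1, 2, 3}" by auto
  with bound show ?thesis by (auto simp: finite_type_pairs_def)
qed (use assms in \<open>auto simp: finite_type_pairs_def\<close>)

section \<open>The fan of rays\<close>

text \<open>
  Applied to \<open>\<alpha> \<beta>\<close>, this is the order of the product of the two simple reflections in the Weyl
  group of the Cartan matrix with off-diagonal entries \<open>-\<alpha>\<close>, \<open>-\<beta>\<close>.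
\<close>

definition coxeter_number :: "int \<Rightarrow> nat" where
  "coxeter_number n = (if n = 0 then 2 else if n = 1 then 3 else if n = 2 then 4 else 6)"

lemma real_of_int_vec_nth [simp]: "real_of_int_vec v $ i = of_int (v $ i)"
  by (simp add: real_of_int_vec_def)

lemma inj_real_of_int_vec: "inj real_of_int_vec"
  by (auto simp: inj_def vec_eq_iff)

lemma mutation_map_rank2_matrix:
  assumes "0 \<le> \<alpha>" "0 \<le> \<beta>"
  shows "mutation_map (rank2_matrix 1 \<alpha> \<beta>) 1 a = vector [- a $ 1, a $ 2 + max (a $ 1) 0 * \<alpha>]"
    and "mutation_map (rank2_matrix 1 \<alpha> \<beta>) 2 a = vector [a $ 1 + min (a $ 2) 0 * \<beta>, - a $ 2]"
  using assms by (simp_all add: vec_eq_iff forall_2 mutation_map_nth)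

lemma discrete_sign_change:
  fixes f :: "nat \<Rightarrow> real"
  assumes "a < b" "f a \<le> 0" "0 \<le> f b"
  shows "\<exists>n\<ge>a. n < b \<and> f n \<le> 0 \<and> 0 \<le> f (Suc n)"
  using assms
proof (induction b)
  case (Suc b)
  show ?case
  proof (cases "f b \<le> 0")
    case True
    with Suc.prems show ?thesis by (intro exI[of _ b]) auto
  next
    case False
    with Suc.prems have "a < b" by (cases "a = b") auto
    with Suc False show ?thesis by fastforce
  qed
qed simp

text \<open>
  The vectors \<open>v\<^sub>m = (X m, Y m)\<close> for \<open>m \<le> h + 1\<close> run clockwise from \<open>e\<^sub>2\<close> through \<open>e\<^sub>1\<close> and the
  fourth quadrant to \<open>-e\<^sub>2\<close> and then \<open>-e\<^sub>1\<close>. The last two assumptions say that the linear maps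
  \<open>(x, y) \<mapsto> (-x, y + \<alpha> x)\<close> and \<open>(x, y) \<mapsto> (x + \<beta> y, -y)\<close>, with which the mutation maps for
  \<open>s = 1\<close> agree where \<open>x \<ge> 0\<close> and where \<open>y \<le> 0\<close>, send \<open>v\<^sub>m\<close> to \<open>-v\<^bsub>h-m\<^esub>\<close> and \<open>v\<^bsub>m+1\<^esub>\<close> to \<open>-v\<^bsub>h+1-m\<^esub>\<close>.
\<close>

locale rank2_fan =
  fixes \<alpha> \<beta> :: int and h :: nat
  fixes X Y :: "nat \<Rightarrow> int"
  defines "X \<equiv> alternating_rec \<beta> \<alpha> 0 1" and "Y \<equiv> alternating_rec \<beta> \<alpha> 1 0"
  assumes nonneg: "0 \<le> \<alpha>" "0 \<le> \<beta>" and h: "2 \<le> h"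
    and fourth_quadrant: "\<And>m. 1 \<le> m \<Longrightarrow> m \<le> h \<Longrightarrow> 0 \<le> X m \<and> Y m \<le> 0"
    and reflection1: "\<And>m. m \<le> h \<Longrightarrow> X (h - m) = X m \<and> Y (h - m) = - (Y m + \<alpha> * X m)"
    and reflection2: "\<And>m. m \<le> h \<Longrightarrow> X (h + 1 - m) = - (X (Suc m) + \<beta> * Y (Suc m)) \<and> Y (h + 1 - m) = Y (Suc m)"
begin

lemma first_rays: "X 0 = 0" "Y 0 = 1" "X (Suc 0) = 1" "Y (Suc 0) = 0"
  by (simp_all add: X_def Y_def)

lemma last_rays: "X h = 0" "Y h = -1" "X (Suc h) = -1" "Y (Suc h) = 0"
  using reflection1[of 0] reflection2[of 0] by (simp_all add: first_rays)

lemma unimodular: "X m * Y (Suc m) - Y m * X (Suc m) = -1"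
proof (induction m)
  case (Suc m)
  define c where "c = (if even m then \<beta> else \<alpha>)"
  have c: "X (Suc (Suc m)) = c * X (Suc m) - X m" "Y (Suc (Suc m)) = c * Y (Suc m) - Y m"
    by (simp_all add: X_def Y_def c_def)
  show ?case using Suc unfolding c by (simp add: algebra_simps)
qed (simp add: first_rays)

definition ray :: "int \<Rightarrow> nat \<Rightarrow> int^2" where
  "ray s m = vector [s * X m, s * Y m]"

lemma ray_nth [simp]: "ray s m $ 1 = s * X m" "ray s m $ 2 = s * Y m"
  by (simp_all add: ray_def)

definition rays :: "int \<Rightarrow> (int^2) set" where
  "rays s = ray s ` {..Suc h}"

definition next_ray :: "nat \<Rightarrow> nat" where
  "next_ray m = (if m = Suc h then 0 else Suc m)"

text \<open>
  Unordered pairs, because the reflections reverse the cyclic order.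
\<close>

definition adjacent :: "int \<Rightarrow> real^2 \<Rightarrow> real^2 \<Rightarrow> bool" where
  "adjacent s u w \<longleftrightarrow> (\<exists>m\<le>Suc h. {u, w} = real_of_int_vec ` {ray s m, ray s (next_ray m)})"

text \<open>
  Modulo \<open>h + 2\<close> this is \<open>m \<mapsto> -2 - m\<close> for direction 1 and \<open>m \<mapsto> -m\<close> for direction 2.
\<close>

definition reflect :: "2 \<Rightarrow> nat \<Rightarrow> nat" where
  "reflect k m = (if k = 1 then if m = Suc h then m else h - m else if m = 0 then 0 else h + 2 - m)"

lemma reflect_le: "m \<le> Suc h \<Longrightarrow> reflect k m \<le> Suc h"
  by (auto simp: reflect_def)

lemma mutation_map_ray_pos:
  assumes "m \<le> Suc h"
  shows "mutation_map (rank2_matrix 1 \<alpha> \<beta>) k (real_of_int_vec (ray 1 m)) = real_of_int_vec (ray (-1) (reflect k m))"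
proof (cases "k = 1")
  case True
  show ?thesis
  proof (cases "m = Suc h")
    case True
    then show ?thesis
      using \<open>k = 1\<close> nonneg by (simp add: vec_eq_iff forall_2 mutation_map_rank2_matrix reflect_def last_rays)
  next
    case False
    with assms have "m \<le> h" by simp
    then have "0 \<le> X m" using fourth_quadrant[of m] by (cases "m = 0") (auto simp: first_rays)
    then show ?thesis
      using \<open>k = 1\<close> False nonneg reflection1[OF \<open>m \<le> h\<close>]
      by (simp add: vec_eq_iff forall_2 mutation_map_rank2_matrix reflect_def mult.commute)
  qed
next
  case False
  then have "k = 2" using exhaust_2 by blast
  show ?thesis
  proof (cases m)
    case 0
    then show ?thesis
      using \<open>k = 2\<close> nonneg by (simp add: vec_eq_iff forall_2 mutation_map_rank2_matrix reflect_def first_rays)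
  next
    case (Suc n)
    with assms have "n \<le> h" by simp
    then have "Y m \<le> 0" using fourth_quadrant[of m] last_rays(4) Suc by (cases "m = Suc h") auto
    moreover have "X (h + 2 - m) = - (X m + \<beta> * Y m)" "Y (h + 2 - m) = Y m"
      using reflection2[OF \<open>n \<le> h\<close>] Suc by simp_all
    moreover have "reflect k m = h + 2 - m" using \<open>k = 2\<close> Suc by (simp add: reflect_def)
    ultimately show ?thesis
      using \<open>k = 2\<close> nonneg
      by (simp add: vec_eq_iff forall_2 mutation_map_rank2_matrix mult.commute)
  qed
qed

lemma uminus_ray: "real_of_int_vec (ray (- s) m) = - real_of_int_vec (ray s m)"
  by (simp add: vec_eq_iff forall_2)

lemma uminus_rank2_matrix: "rank2_matrix (- s) \<alpha> \<beta> = - rank2_matrix s \<alpha> \<beta>"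
  by (simp add: vec_eq_iff forall_2)

text \<open>
  The sign \<open>-1\<close> reduces to the sign \<open>1\<close> by the antipodal symmetry \<open>mutation_map_minus\<close>.
\<close>

lemma mutation_map_ray:
  assumes "\<bar>s\<bar> = 1" "m \<le> Suc h"
  shows "mutation_map (rank2_matrix s \<alpha> \<beta>) k (real_of_int_vec (ray s m)) = real_of_int_vec (ray (- s) (reflect k m))"
proof -
  consider "s = 1" | "s = -1" using assms(1) by linarith
  then show ?thesis
  proof cases
    case 1
    then show ?thesis using mutation_map_ray_pos[OF assms(2)] by simp
  next
    case 2
    have "mutation_map (- rank2_matrix 1 \<alpha> \<beta>) k (- real_of_int_vec (ray 1 m)) = - real_of_int_vec (ray (-1) (reflect k m))"
      using mutation_map_ray_pos[OF assms(2)] by (simp add: mutation_map_minus)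
    then show ?thesis using 2 uminus_ray[of 1] uminus_ray[of "-1"] uminus_rank2_matrix[of 1] by simp
  qed
qed

lemma reflect_adjacent:
  assumes "m \<le> Suc h"
  shows "\<exists>n\<le>Suc h. {reflect k m, reflect k (next_ray m)} = {n, next_ray n}"
proof (cases "k = 1")
  case True
  consider "m < h" | "m = h" | "m = Suc h" using assms by linarith
  then show ?thesis
  proof cases
    case 1
    then show ?thesis using True by (intro exI[of _ "h - Suc m"]) (auto simp: reflect_def next_ray_def)
  next
    case 2
    then show ?thesis using True by (intro exI[of _ "Suc h"]) (auto simp: reflect_def next_ray_def)
  next
    case 3
    then show ?thesis using True by (intro exI[of _ h]) (auto simp: reflect_def next_ray_def)
  qed
next
  case False
  show ?thesis
  proof (cases "m = 0")
    case True
    then show ?thesis using False by (intro exI[of _ "Suc h"]) (auto simp: reflect_def next_ray_def)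
  next
    case m: False
    then show ?thesis using False assms by (intro exI[of _ "h + 1 - m"]) (auto simp: reflect_def next_ray_def)
  qed
qed

lemma next_ray_le: "m \<le> Suc h \<Longrightarrow> next_ray m \<le> Suc h"
  by (auto simp: next_ray_def)

lemma mutate_seq_rank2_matrix:
  "mutate_seq id (rank2_matrix s \<alpha> \<beta>) ks = rank2_matrix ((-1) ^ length ks * s) \<alpha> \<beta>"
proof (induction ks)
  case (Cons k ks)
  show ?case unfolding mutate_seq.simps Cons mutate_rank2_matrix[OF nonneg] by simp
qed simp

lemma adjacent_same_orthant:
  assumes "\<bar>s\<bar> = 1" "adjacent s u w"
  shows "same_orthant u w"
proof -
  obtain m where m: "m \<le> Suc h" "{u, w} = real_of_int_vec ` {ray s m, ray s (next_ray m)}"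
    using assms(2) by (auto simp: adjacent_def)
  have s: "s = 1 \<or> s = -1" using assms(1) by linarith
  consider "m = 0" | "1 \<le> m" "m < h" | "m = h" | "m = Suc h" using m(1) by linarith
  then have "same_orthant (real_of_int_vec (ray s m)) (real_of_int_vec (ray s (next_ray m)))"
  proof cases
    case 2
    then show ?thesis
      using s fourth_quadrant[of m] fourth_quadrant[of "Suc m"]
      by (auto simp: same_orthant_def forall_2 next_ray_def)
  qed (use s h in \<open>auto simp: same_orthant_def forall_2 next_ray_def first_rays last_rays\<close>)
  with m(2) show ?thesis
    by (auto simp: doubleton_eq_iff same_orthant_commute)
qed

lemma mutation_map_adjacent:
  assumes "\<bar>s\<bar> = 1" "adjacent s u w"
  shows "adjacent (- s) (mutation_map (rank2_matrix s \<alpha> \<beta>) k u) (mutation_map (rank2_matrix s \<alpha> \<beta>) k w)"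
proof -
  let ?\<eta> = "mutation_map (rank2_matrix s \<alpha> \<beta>) k"
  obtain m where m: "m \<le> Suc h" "{u, w} = real_of_int_vec ` {ray s m, ray s (next_ray m)}"
    using assms(2) by (auto simp: adjacent_def)
  obtain n where n: "n \<le> Suc h" "{reflect k m, reflect k (next_ray m)} = {n, next_ray n}"
    using reflect_adjacent[OF m(1)] by blast
  have "{?\<eta> u, ?\<eta> w} = ?\<eta> ` {u, w}" by simp
  also have "\<dots> = (\<lambda>m. real_of_int_vec (ray (- s) m)) ` {reflect k m, reflect k (next_ray m)}"
    unfolding m(2) by (simp add: mutation_map_ray assms(1) m(1) next_ray_le)
  also have "\<dots> = real_of_int_vec ` {ray (- s) n, ray (- s) (next_ray n)}"
    unfolding n(2) by simp
  finally show ?thesis using n(1) unfolding adjacent_def by blast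
qed

lemma mutation_map_seq_adjacent:
  assumes "\<bar>s\<bar> = 1" "adjacent s u w"
  shows "adjacent ((-1) ^ length ks * s) (mutation_map_seq (rank2_matrix s \<alpha> \<beta>) ks u) (mutation_map_seq (rank2_matrix s \<alpha> \<beta>) ks w)"
proof (induction ks)
  case (Cons k ks)
  have "\<bar>(-1) ^ length ks * s\<bar> = 1" using assms(1) by (simp add: abs_mult power_abs)
  from mutation_map_adjacent[OF this Cons] show ?case by (simp add: mutate_seq_rank2_matrix)
qed (simp add: assms(2))

text \<open>
  \<open>D m\<close> is, up to the sign \<open>s\<close>, the determinant of \<open>v\<^sub>m\<close> and \<open>a\<close>, so a sign change between
  neighbours means that \<open>a\<close> lies in their cone. In the quadrant that contains the inner rays a
  sign change occurs somewhere between \<open>v\<^sub>1\<close> and \<open>v\<^sub>h\<close>; the other three quadrants are themselves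
  cones of the fan.
\<close>

lemma fan_complete:
  fixes a :: "real^2" and s :: int
  assumes "\<bar>s\<bar> = 1"
  defines "D \<equiv> (\<lambda>m. s * (X m * a $ 2 - Y m * a $ 1))"
  shows "\<exists>m\<le>Suc h. D m \<le> 0 \<and> 0 \<le> D (next_ray m)"
proof -
  have D: "D 0 = - s * a $ 1" "D 1 = s * a $ 2" "D h = s * a $ 1" "D (Suc h) = - s * a $ 2"
    by (simp_all add: D_def first_rays last_rays)
  show ?thesis
  proof (cases "0 \<le> s * a $ 1"; cases "0 \<le> s * a $ 2")
    assume "0 \<le> s * a $ 1" "0 \<le> s * a $ 2"
    then show ?thesis using D by (intro exI[of _ 0]) (simp add: next_ray_def)
  next
    assume *: "0 \<le> s * a $ 1" "\<not> 0 \<le> s * a $ 2"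
    obtain m where "1 \<le> m" "m < h" "D m \<le> 0" "0 \<le> D (Suc m)"
      using discrete_sign_change[of 1 h D] * D h by auto
    then show ?thesis by (intro exI[of _ m]) (simp add: next_ray_def)
  next
    assume "\<not> 0 \<le> s * a $ 1" "0 \<le> s * a $ 2"
    then show ?thesis using D by (intro exI[of _ "Suc h"]) (simp add: next_ray_def)
  next
    assume "\<not> 0 \<le> s * a $ 1" "\<not> 0 \<le> s * a $ 2"
    then show ?thesis using D by (intro exI[of _ h]) (simp add: next_ray_def)
  qed
qed

lemma unimodular_next:
  assumes "m \<le> Suc h"
  shows "X m * Y (next_ray m) - Y m * X (next_ray m) = -1"
  using assms unimodular[of m] by (auto simp: next_ray_def first_rays last_rays)

section \<open>The rays form a positive basis\<close>

text \<open>
  Cramer's rule in a cone of the fan that contains \<open>a\<close>: the determinant of the two rays is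
  \<open>-1\<close>, so the coefficients are integral combinations of the coordinates of \<open>a\<close>.
\<close>

lemma rays_span_positively:
  assumes R: "underlying_ring R" and s: "\<bar>s\<bar> = 1" and a: "a \<in> vectors_over R"
  shows "\<exists>S c. finite S \<and> S \<subseteq> rays s \<and> (\<forall>i\<in>S. c i \<in> R \<and> c i > 0) \<and>
            coherently_expressed R (rank2_matrix s \<alpha> \<beta>) a S c real_of_int_vec"
proof -
  define D :: "nat \<Rightarrow> real" where "D m = s * (X m * a $ 2 - Y m * a $ 1)" for m
  obtain m where m: "m \<le> Suc h" "D m \<le> 0" "0 \<le> D (next_ray m)"
    using fan_complete[OF s, of a] by (auto simp: D_def)
  let ?n = "next_ray m"
  have D_in_R: "- D m \<in> R" "D m \<in> R" for m
  proof -
    have aR: "a $ 1 \<in> R" "a $ 2 \<in> R" using a by (simp_all add: vectors_over_def)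
    have int: "of_int z \<in> R" for z using underlying_ring_closed(1)[OF R] by auto
    have 0: "0 \<in> R" using int[of 0] by simp
    show "D m \<in> R" unfolding D_def by (intro underlying_ring_closed[OF R] aR int)
    from underlying_ring_closed(2)[OF R 0 this] show "- D m \<in> R" by simp
  qed
  have det: "real_of_int (X m) * Y ?n - Y m * X ?n = -1"
    using unimodular_next[OF m(1)] by (metis of_int_1 of_int_diff of_int_minus of_int_mult)
  have ss: "real_of_int s * s = 1"
    using s by (metis abs_mult_self_eq mult_1 of_int_1 of_int_mult)
  have "a = D ?n *\<^sub>R real_of_int_vec (ray s m) + (- D m) *\<^sub>R real_of_int_vec (ray s ?n)"
  proof -
    have "D ?n * (s * X m) - D m * (s * X ?n) = (real_of_int s * s) * - (real_of_int (X m) * Y ?n - Y m * X ?n) * a $ 1"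
      unfolding D_def by (simp add: algebra_simps)
    moreover have "D ?n * (s * Y m) - D m * (s * Y ?n) = (real_of_int s * s) * - (real_of_int (X m) * Y ?n - Y m * X ?n) * a $ 2"
      unfolding D_def by (simp add: algebra_simps)
    ultimately show ?thesis
      unfolding det ss by (simp add: vec_eq_iff forall_2)
  qed
  moreover have "same_orthant (mutation_map_seq (rank2_matrix s \<alpha> \<beta>) ks (real_of_int_vec (ray s m)))
      (mutation_map_seq (rank2_matrix s \<alpha> \<beta>) ks (real_of_int_vec (ray s ?n)))" for ks
  proof -
    have "adjacent s (real_of_int_vec (ray s m)) (real_of_int_vec (ray s ?n))"
      using m(1) by (auto simp: adjacent_def)
    moreover have "\<bar>(-1) ^ length ks * s\<bar> = 1" using s by (simp add: abs_mult power_abs)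
    ultimately show ?thesis
      using adjacent_same_orthant mutation_map_seq_adjacent[OF s] by blast
  qed
  moreover have "ray s m \<in> rays s" "ray s ?n \<in> rays s"
    using m(1) next_ray_le by (auto simp: rays_def)
  moreover have "ray s m \<noteq> ray s ?n"
  proof
    assume "ray s m = ray s ?n"
    then have "s * X m = s * X ?n" "s * Y m = s * Y ?n" by (metis ray_nth)+
    then have "X m = X ?n" "Y m = Y ?n" using s by auto
    then show False using unimodular_next[OF m(1)] by simp
  qed
  ultimately show ?thesis
    using m D_in_R R
    by (intro coherently_expressed_cone[where i = "ray s m" and j = "ray s ?n" and c = "D ?n" and d = "- D m"])
      simp_all
qed

lemma mutation_map_seq_ray:
  assumes "\<bar>s\<bar> = 1" "m \<le> Suc h"
  shows "\<exists>n\<le>Suc h. mutation_map_seq (rank2_matrix s \<alpha> \<beta>) ks (real_of_int_vec (ray s m))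
      = real_of_int_vec (ray ((-1) ^ length ks * s) n)"
proof (induction ks)
  case (Cons k ks)
  have "\<bar>(-1) ^ length ks * s\<bar> = 1" using assms(1) by (simp add: abs_mult power_abs)
  from mutation_map_ray[OF this] Cons reflect_le show ?case
    by (fastforce simp: mutate_seq_rank2_matrix)
qed (use assms in auto)

text \<open>
  Mutating in direction 1 and then 2 moves the index \<open>m\<close> to \<open>m + 2\<close>, so one arrives at \<open>h + 1\<close>
  or at \<open>h\<close>, and in the latter case direction 1 leads from \<open>h\<close> to \<open>0\<close>.
\<close>

lemma extremal_ray_reachable:
  assumes s: "\<bar>s\<bar> = 1" and "m \<le> Suc h"
  shows "\<exists>ks n. mutation_map_seq (rank2_matrix s \<alpha> \<beta>) ks (real_of_int_vec (ray s m))
      = real_of_int_vec (ray ((-1) ^ length ks * s) n) \<and> (n = 0 \<or> n = Suc h)"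
  using assms(2)
proof (induction "Suc h - m" arbitrary: m rule: less_induct)
  case less
  consider "m = Suc h" | "m = h" | "m < h" using less.prems by linarith
  then show ?case
  proof cases
    case 1
    then show ?thesis by (intro exI[of _ "[]"] exI[of _ m]) simp
  next
    case 2
    then show ?thesis
      using mutation_map_ray[OF s, of h 1] by (intro exI[of _ "[1]"] exI[of _ 0]) (simp add: reflect_def)
  next
    case 3
    have refl: "reflect 1 m = h - m" "reflect 2 (h - m) = m + 2" using 3 by (auto simp: reflect_def)
    have two: "mutation_map_seq (rank2_matrix s \<alpha> \<beta>) [2, 1] (real_of_int_vec (ray s m)) = real_of_int_vec (ray s (m + 2))"
      using mutation_map_ray[OF s, of m 1] mutation_map_ray[of "- s" "h - m" 2] s 3
      unfolding mutation_map_seq.simps mutate_seq.simps mutate_rank2_matrix[OF nonneg] by (simp add: refl)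
    have "Suc h - (m + 2) < Suc h - m" "m + 2 \<le> Suc h" using 3 by linarith+
    from less.hyps[OF this]
    obtain ks n where ks: "mutation_map_seq (rank2_matrix s \<alpha> \<beta>) ks (real_of_int_vec (ray s (m + 2)))
      = real_of_int_vec (ray ((-1) ^ length ks * s) n)" and n: "n = 0 \<or> n = Suc h"
      by blast
    have "mutation_map_seq (rank2_matrix s \<alpha> \<beta>) (ks @ [2, 1]) (real_of_int_vec (ray s m))
        = real_of_int_vec (ray ((-1) ^ length (ks @ [2, 1 :: 2]) * s) n)"
      unfolding mutation_map_seq_append two mutate_seq.simps mutate_rank2_matrix[OF nonneg] using ks by simp
    with n show ?thesis by blast
  qed
qed

text \<open>
  Move the ray to one of the two ends of the fan. There a half-plane separates it from all
  other rays of the fan of the mutated matrix, whose sign is \<open>t\<close>.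
\<close>

lemma rays_independent:
  assumes s: "\<bar>s\<bar> = 1" and S: "S \<subseteq> rays s" and rel: "coherent_relation R (rank2_matrix s \<alpha> \<beta>) S c real_of_int_vec"
    and v: "v \<in> S"
  shows "c v = 0"
proof -
  obtain m where m: "m \<le> Suc h" "v = ray s m" using S v by (auto simp: rays_def)
  obtain ks n where ks: "mutation_map_seq (rank2_matrix s \<alpha> \<beta>) ks (real_of_int_vec v)
      = real_of_int_vec (ray ((-1) ^ length ks * s) n)" and n: "n = 0 \<or> n = Suc h"
    using extremal_ray_reachable[OF s m(1)] m(2) by auto
  define t where "t = (-1) ^ length ks * s"
  have t: "\<bar>t\<bar> = 1" using s by (simp add: t_def abs_mult power_abs)
  then have tt: "real_of_int t * t = 1" by (metis abs_mult_self_eq mult_1 of_int_1 of_int_mult)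
  have image: "\<exists>n'\<le>Suc h. mutation_map_seq (rank2_matrix s \<alpha> \<beta>) ks (real_of_int_vec v') = real_of_int_vec (ray t n')"
    if "v' \<in> S" for v'
    using that S mutation_map_seq_ray[OF s] by (auto simp: rays_def t_def)
  show ?thesis
    using n
  proof
    assume "n = 0"
    show ?thesis
    proof (rule coherent_relation_coeff_zero[OF rel, where s = t and j = 2 and ks = ks])
      show "0 < t * mutation_map_seq (rank2_matrix s \<alpha> \<beta>) ks (real_of_int_vec v) $ 2"
        using ks tt by (simp add: \<open>n = 0\<close> t_def[symmetric] first_rays)
    next
      fix v' assume v': "v' \<in> S" "mutation_map_seq (rank2_matrix s \<alpha> \<beta>) ks (real_of_int_vec v') \<noteq> mutation_map_seq (rank2_matrix s \<alpha> \<beta>) ks (real_of_int_vec v)"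
      obtain n' where n': "n' \<le> Suc h" "mutation_map_seq (rank2_matrix s \<alpha> \<beta>) ks (real_of_int_vec v') = real_of_int_vec (ray t n')"
        using image v'(1) by blast
      with v'(2) ks have "n' \<noteq> 0" by (metis \<open>n = 0\<close> t_def)
      then have "Y n' \<le> 0" using fourth_quadrant[of n'] last_rays(4) n'(1) by (cases "n' = Suc h") auto
      then show "t * mutation_map_seq (rank2_matrix s \<alpha> \<beta>) ks (real_of_int_vec v') $ 2 \<le> 0"
        using tt by (simp add: n'(2) mult.assoc[symmetric])
    qed (use t v inj_real_of_int_vec in \<open>auto intro: inj_on_subset\<close>)
  next
    assume "n = Suc h"
    show ?thesis
    proof (rule coherent_relation_coeff_zero[OF rel, where s = "- t" and j = 1 and ks = ks])
      show "0 < real_of_int (- t) * mutation_map_seq (rank2_matrix s \<alpha> \<beta>) ks (real_of_int_vec v) $ 1"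
        using ks tt by (simp add: \<open>n = Suc h\<close> t_def[symmetric] last_rays)
    next
      fix v' assume v': "v' \<in> S" "mutation_map_seq (rank2_matrix s \<alpha> \<beta>) ks (real_of_int_vec v') \<noteq> mutation_map_seq (rank2_matrix s \<alpha> \<beta>) ks (real_of_int_vec v)"
      obtain n' where n': "n' \<le> Suc h" "mutation_map_seq (rank2_matrix s \<alpha> \<beta>) ks (real_of_int_vec v') = real_of_int_vec (ray t n')"
        using image v'(1) by blast
      with v'(2) ks have "n' \<noteq> Suc h" by (metis \<open>n = Suc h\<close> t_def)
      then have "0 \<le> X n'" using fourth_quadrant[of n'] n'(1) by (cases "n' = 0") (auto simp: first_rays)
      then show "real_of_int (- t) * mutation_map_seq (rank2_matrix s \<alpha> \<beta>) ks (real_of_int_vec v') $ 1 \<le> 0"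
        using tt by (simp add: n'(2) mult.assoc[symmetric])
    qed (use t v inj_real_of_int_vec in \<open>auto intro: inj_on_subset\<close>)
  qed
qed

theorem rays_positive_basis:
  assumes "underlying_ring R" "\<bar>s\<bar> = 1"
  shows "positive_basis_for R (rank2_matrix s \<alpha> \<beta>) (rays s) real_of_int_vec"
proof -
  have "real_of_int_vec v \<in> vectors_over R" for v :: "int^2"
    using underlying_ring_closed(1)[OF assms(1)] by (auto simp: vectors_over_def)
  then show ?thesis
    using rays_span_positively[OF assms] rays_independent[OF assms(2)]
    unfolding positive_basis_for_def basis_for_def by meson
qed

end

text \<open>
  For each of the six pairs this is a finite computation.
\<close>

lemma finite_type_fan:
  assumes "(\<alpha>, \<beta>) \<in> finite_type_pairs"
  shows "rank2_fan \<alpha> \<beta> (coxeter_number (\<alpha> * \<beta>))"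
proof -
  let ?P = "\<lambda>\<alpha> \<beta> h X Y.
     0 \<le> \<alpha> \<and> 0 \<le> \<beta> \<and> 2 \<le> h \<and>
     (\<forall>m \<in> set [1..<Suc h]. 0 \<le> X m \<and> Y m \<le> 0) \<and>
     (\<forall>m \<in> set [0..<Suc h]. X (h - m) = X m \<and> Y (h - m) = - (Y m + \<alpha> * X m) \<and>
        X (h + 1 - m) = - (X (Suc m) + \<beta> * Y (Suc m)) \<and> Y (h + 1 - m) = Y (Suc m))"
  have "\<forall>(\<alpha>, \<beta>) \<in> finite_type_pairs.
     ?P \<alpha> \<beta> (coxeter_number (\<alpha> * \<beta>)) (alternating_rec \<beta> \<alpha> 0 1) (alternating_rec \<beta> \<alpha> 1 0)"
    by code_simp
  from bspec[OF this assms]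
  have P: "?P \<alpha> \<beta> (coxeter_number (\<alpha> * \<beta>)) (alternating_rec \<beta> \<alpha> 0 1) (alternating_rec \<beta> \<alpha> 1 0)"
    unfolding prod.case .
  show ?thesis
  proof
    show "0 \<le> \<alpha>" "0 \<le> \<beta>" "2 \<le> coxeter_number (\<alpha> * \<beta>)" using P by blast+
  next
    fix m assume m: "1 \<le> m" "m \<le> coxeter_number (\<alpha> * \<beta>)"
    then have "m \<in> set [1..<Suc (coxeter_number (\<alpha> * \<beta>))]" by (auto simp del: upt_Suc)
    with P show "0 \<le> alternating_rec \<beta> \<alpha> 0 1 m \<and> alternating_rec \<beta> \<alpha> 1 0 m \<le> 0" by blast
  next
    fix m assume m: "m \<le> coxeter_number (\<alpha> * \<beta>)"
    then have m: "m \<in> set [0..<Suc (coxeter_number (\<alpha> * \<beta>))]" by (auto simp del: upt_Suc)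
    with P show "alternating_rec \<beta> \<alpha> 0 1 (coxeter_number (\<alpha> * \<beta>) - m) = alternating_rec \<beta> \<alpha> 0 1 m \<and>
        alternating_rec \<beta> \<alpha> 1 0 (coxeter_number (\<alpha> * \<beta>) - m) = - (alternating_rec \<beta> \<alpha> 1 0 m + \<alpha> * alternating_rec \<beta> \<alpha> 0 1 m)"
      by blast
    from m P show "alternating_rec \<beta> \<alpha> 0 1 (coxeter_number (\<alpha> * \<beta>) + 1 - m) =
          - (alternating_rec \<beta> \<alpha> 0 1 (Suc m) + \<beta> * alternating_rec \<beta> \<alpha> 1 0 (Suc m)) \<and>
        alternating_rec \<beta> \<alpha> 1 0 (coxeter_number (\<alpha> * \<beta>) + 1 - m) = alternating_rec \<beta> \<alpha> 1 0 (Suc m)"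
      by blast
  qed
qed

section \<open>Computation of the g-vectors\<close>

text \<open>
  The data along an alternating path, seen from the step to come: if \<open>i\<close> is the index to be
  mutated next and \<open>j\<close> the other one, a state consists of the entries \<open>(i, j)\<close> and \<open>(j, i)\<close> of
  the exchange matrix, the bottom parts of the columns \<open>i\<close> and \<open>j\<close> of the extended matrix, and
  the \<open>g\<close>-vectors with labels \<open>i\<close> and \<open>j\<close>. Coordinates of vectors are listed starting with the
  index \<open>k\<close> of the first mutation, so that one step function serves both directions of the
  path.
\<close>

type_synonym g_state = "(int \<times> int) \<times> (int \<times> int) \<times> (int \<times> int) \<times> (int \<times> int) \<times> (int \<times> int)"

text \<open>
  The parameters \<open>p\<^sub>0\<close>, \<open>q\<^sub>0\<close> are the entries of the initial exchange matrix, whose columns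
  \<open>(0, q\<^sub>0)\<close> and \<open>(p\<^sub>0, 0)\<close> enter the recursion for \<open>g\<close>-vectors. A step exchanges the roles of
  \<open>i\<close> and \<open>j\<close>.
\<close>

fun g_step :: "int \<Rightarrow> int \<Rightarrow> g_state \<Rightarrow> g_state" where
  "g_step p\<^sub>0 q\<^sub>0 ((p, q), (a, a'), (b, b'), (x, x'), (y, y')) =
     ((- q, - p), (b + sgn p * max (a * p) 0, b' + sgn p * max (a' * p) 0), (- a, - a'),
      (y, y'), (- x + max q 0 * y - max a' 0 * p\<^sub>0, - x' + max q 0 * y' - max a 0 * q\<^sub>0))"

primrec g_walk :: "int \<Rightarrow> int \<Rightarrow> nat \<Rightarrow> g_state" where
  "g_walk p\<^sub>0 q\<^sub>0 0 = ((p\<^sub>0, q\<^sub>0), (1, 0), (0, 1), (1, 0), (0, 1))"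
| "g_walk p\<^sub>0 q\<^sub>0 (Suc n) = g_step p\<^sub>0 q\<^sub>0 (g_walk p\<^sub>0 q\<^sub>0 n)"

definition walk_g_vector :: "int \<Rightarrow> int \<Rightarrow> nat \<Rightarrow> int \<times> int" where
  "walk_g_vector p q n = (case g_walk p q n of (_, _, _, x, _) \<Rightarrow> x)"

lemma sum_rank2: "(\<Sum>i\<in>UNIV. f i) = f k + f (k + 1)" for k :: 2
proof -
  consider "k = 1" | "k = 2" using exhaust_2 by blast
  then show ?thesis
    by cases (simp_all only: two_add_one one_add_one sum_2 add.commute[of "f 1" "f 2"])
qed

lemma forall_rank2: "(\<forall>i. P i) \<longleftrightarrow> P k \<and> P (k + 1)" for k :: 2
  using other_index[of _ k] by metis

lemma g_walk_correct:
  assumes M: "M $ k $ k = 0" "M $ (k + 1) $ (k + 1) = 0" "M $ k $ (k + 1) = p\<^sub>0" "M $ (k + 1) $ k = q\<^sub>0"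
    and sign: "p\<^sub>0 * q\<^sub>0 \<le> 0"
  shows "let i = (if even n then k else k + 1); P = principal_matrix_at M (alternating k n);
             g = g_vector M (alternating k n)
         in P $ Inl i $ i = 0 \<and> P $ Inl (i + 1) $ (i + 1) = 0 \<and> P $ Inl i $ (i + 1) * P $ Inl (i + 1) $ i \<le> 0 \<and>
            g_walk p\<^sub>0 q\<^sub>0 n =
              ((P $ Inl i $ (i + 1), P $ Inl (i + 1) $ i),
               (P $ Inr k $ i, P $ Inr (k + 1) $ i), (P $ Inr k $ (i + 1), P $ Inr (k + 1) $ (i + 1)),
               (g i $ k, g i $ (k + 1)), (g (i + 1) $ k, g (i + 1) $ (k + 1)))"
proof (induction n)
  case 0
  show ?case
    using M sign by (simp add: principal_matrix_at_def principal_extension_def axis_def)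
next
  case (Suc n)
  define i where "i = (if even n then k else k + 1)"
  define P where "P = principal_matrix_at M (alternating k n)"
  define g where "g = g_vector M (alternating k n)"
  define P' where "P' = principal_matrix_at M (alternating k (Suc n))"
  define g' where "g' = g_vector M (alternating k (Suc n))"
  have IH: "P $ Inl i $ i = 0" "P $ Inl (i + 1) $ (i + 1) = 0" "P $ Inl i $ (i + 1) * P $ Inl (i + 1) $ i \<le> 0"
     "g_walk p\<^sub>0 q\<^sub>0 n =
              ((P $ Inl i $ (i + 1), P $ Inl (i + 1) $ i),
               (P $ Inr k $ i, P $ Inr (k + 1) $ i), (P $ Inr k $ (i + 1), P $ Inr (k + 1) $ (i + 1)),
               (g i $ k, g i $ (k + 1)), (g (i + 1) $ k, g (i + 1) $ (k + 1)))"
    using Suc by (auto simp: Let_def i_def P_def g_def)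
  have i': "(if even (Suc n) then k else k + 1) = i + 1" by (simp add: i_def)
  have P': "P' = mutate Inl i P" by (simp add: P'_def P_def i_def principal_matrix_at_def)
  have g': "g' (i + 1) = g (i + 1)"
    "g' i = - g i + (\<Sum>j\<in>UNIV. max (P $ Inl j $ i) 0 *s g j) - (\<Sum>j\<in>UNIV. max (P $ Inr j $ i) 0 *s column j M)"
    by (simp_all add: g'_def g_def P_def i_def)
  have g'_nth: "g' i $ l = - g i $ l + max (P $ Inl (i + 1) $ i) 0 * g (i + 1) $ l
      - max (P $ Inr k $ i) 0 * M $ l $ k - max (P $ Inr (k + 1) $ i) 0 * M $ l $ (k + 1)" for l
    unfolding g'(2) sum_rank2[of "\<lambda>j. max (P $ Inl j $ i) 0 *s g j" i]
      sum_rank2[of "\<lambda>j. max (P $ Inr j $ i) 0 *s column j M" k]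
    by (simp add: IH(1) column_def)
  have top: "P' $ Inl i $ i = 0" "P' $ Inl (i + 1) $ (i + 1) = 0"
    "P' $ Inl i $ (i + 1) = - P $ Inl i $ (i + 1)" "P' $ Inl (i + 1) $ i = - P $ Inl (i + 1) $ i"
    using IH(1-3) by (simp_all add: P' mutate_def mult.commute max_def)
  have bottom: "P' $ Inr j $ i = - P $ Inr j $ i"
    "P' $ Inr j $ (i + 1) = P $ Inr j $ (i + 1) + sgn (P $ Inl i $ (i + 1)) * max (P $ Inr j $ i * P $ Inl i $ (i + 1)) 0" for j
    by (simp_all add: P' mutate_def)
  show ?case
    unfolding i' Let_def P'_def[symmetric] g'_def[symmetric] g_walk.simps IH(4)
    using IH(3) by (simp add: top bottom g'(1) g'_nth M mult.commute)
qed

text \<open>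
  The second vector of a state is the first one of the next state, hence the first components
  of the states already give all \<open>g\<close>-vectors on one side of the base vertex.
\<close>

lemma g_vectors_walk:
  fixes M :: "int^2^2"
  assumes "M $ 1 $ 1 = 0" "M $ 2 $ 2 = 0" "M $ 1 $ 2 * M $ 2 $ 1 \<le> 0"
  shows "g_vectors M = {v. (v $ 1, v $ 2) \<in> range (walk_g_vector (M $ 1 $ 2) (M $ 2 $ 1))}
     \<union> {v. (v $ 2, v $ 1) \<in> range (walk_g_vector (M $ 2 $ 1) (M $ 1 $ 2))}"
proof -
  define dir where "dir k = {v. \<exists>n. walk_g_vector (M $ k $ (k + 1)) (M $ (k + 1) $ k) n = (v $ k, v $ (k + 1))}" for k :: 2
  have dir: "{g_vector M (alternating k n) l | n l. True} = dir k" for k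
  proof -
    have diag: "M $ k $ k = 0" "M $ (k + 1) $ (k + 1) = 0" "M $ k $ (k + 1) * M $ (k + 1) $ k \<le> 0"
    proof -
      have swapped: "M $ 2 $ 1 * M $ 1 $ 2 \<le> 0" using assms(3) by (simp only: mult.commute)
      consider "k = 1" | "k = 2" using exhaust_2 by blast
      then show "M $ k $ k = 0" "M $ (k + 1) $ (k + 1) = 0" "M $ k $ (k + 1) * M $ (k + 1) $ k \<le> 0"
        by (cases; simp only: two_add_one one_add_one assms swapped)+
    qed
    note walk = g_walk_correct[OF diag(1,2) refl refl diag(3), unfolded Let_def]
    let ?i = "\<lambda>n. if even n then k else k + 1"
    have first: "walk_g_vector (M $ k $ (k + 1)) (M $ (k + 1) $ k) n =
       (g_vector M (alternating k n) (?i n) $ k, g_vector M (alternating k n) (?i n) $ (k + 1))" for n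
      using walk[of n] by (simp add: walk_g_vector_def)
    have eq: "walk_g_vector (M $ k $ (k + 1)) (M $ (k + 1) $ k) n = (v $ k, v $ (k + 1)) \<longleftrightarrow>
        v = g_vector M (alternating k n) (?i n)" for n v
      unfolding first vec_eq_iff forall_rank2[of _ k] by auto
    have second: "g_vector M (alternating k n) (?i n + 1) = g_vector M (alternating k (Suc n)) (?i (Suc n))" for n
      by simp
    have "\<exists>m. g_vector M (alternating k n) l = g_vector M (alternating k m) (?i m)" for n l
    proof (cases "l = ?i n")
      case True
      show ?thesis unfolding True by (rule exI[of _ n]) (rule refl)
    next
      case False
      then have l: "l = ?i n + 1" by (simp only: other_index)
      show ?thesis unfolding l second by (rule exI[of _ "Suc n"]) (rule refl)
    qed
    then show ?thesis unfolding dir_def eq by blast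
  qed
  have "g_vectors M = dir 1 \<union> dir 2"
  proof -
    have "g_vectors M = (\<Union>k. {g_vector M (alternating k n) l | n l. True})"
      by (auto simp: g_vectors_def tree_vertices_rank2)
    then show ?thesis unfolding dir UNIV_2 by simp
  qed
  then show ?thesis
    unfolding dir_def two_add_one one_add_one image_def by (simp only: bex_UNIV eq_commute mem_Collect_eq)
qed

lemma g_walk_periodic:
  assumes "g_walk p q N = g_walk p q 0" "0 < N"
  shows "range (walk_g_vector p q) = set (map (walk_g_vector p q) [0..<N])"
proof -
  have "g_walk p q n = (g_step p q ^^ n) (g_walk p q 0)" for n
    by (induction n) auto
  then have "g_walk p q n = g_walk p q (n mod N)" for n
    using assms(1) funpow_mod_eq by metis
  then have "walk_g_vector p q n = walk_g_vector p q (n mod N)" for n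
    by (simp add: walk_g_vector_def)
  with assms(2) show ?thesis
    by (auto simp: image_def) (metis mod_less_divisor atLeastLessThan_iff zero_le)
qed

text \<open>
  In either direction the walk passes through each of the \<open>h + 2\<close> rays and is back in its
  initial state after \<open>h + 2\<close> steps. In the direction that starts with index 2 the coordinates
  are swapped.
\<close>

lemma g_walk_rays:
  fixes \<alpha> \<beta> s :: int
  assumes "(\<alpha>, \<beta>) \<in> finite_type_pairs" "\<bar>s\<bar> = 1"
  defines "h \<equiv> coxeter_number (\<alpha> * \<beta>)"
    and "v \<equiv> \<lambda>m. (s * alternating_rec \<beta> \<alpha> 0 1 m, s * alternating_rec \<beta> \<alpha> 1 0 m)"
  shows "range (walk_g_vector (- s * \<beta>) (s * \<alpha>)) = v ` {..Suc h}"
    and "range (walk_g_vector (s * \<alpha>) (- s * \<beta>)) = prod.swap ` v ` {..Suc h}"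
proof -
  let ?P = "\<lambda>\<alpha> \<beta> s N v.
     g_walk (- s * \<beta>) (s * \<alpha>) N = g_walk (- s * \<beta>) (s * \<alpha>) 0 \<and>
     g_walk (s * \<alpha>) (- s * \<beta>) N = g_walk (s * \<alpha>) (- s * \<beta>) 0 \<and>
     set (map (walk_g_vector (- s * \<beta>) (s * \<alpha>)) [0..<N]) = set (map v [0..<N]) \<and>
     set (map (walk_g_vector (s * \<alpha>) (- s * \<beta>)) [0..<N]) = set (map (prod.swap \<circ> v) [0..<N])"
  have "\<forall>s \<in> {1, -1}. \<forall>(\<alpha>, \<beta>) \<in> finite_type_pairs.
     ?P \<alpha> \<beta> s (Suc (Suc (coxeter_number (\<alpha> * \<beta>))))
       (\<lambda>m. (s * alternating_rec \<beta> \<alpha> 0 1 m, s * alternating_rec \<beta> \<alpha> 1 0 m))"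
    by code_simp
  moreover have "s \<in> {1, -1}" using assms(2) by auto
  ultimately have P: "?P \<alpha> \<beta> s (Suc (Suc h)) v"
    using assms(1) unfolding h_def v_def by blast
  have interval: "{0..<Suc (Suc h)} = {..Suc h}" by auto
  show "range (walk_g_vector (- s * \<beta>) (s * \<alpha>)) = v ` {..Suc h}"
    using g_walk_periodic[of "- s * \<beta>" "s * \<alpha>" "Suc (Suc h)"] P unfolding set_map set_upt interval by simp
  show "range (walk_g_vector (s * \<alpha>) (- s * \<beta>)) = prod.swap ` v ` {..Suc h}"
    using g_walk_periodic[of "s * \<alpha>" "- s * \<beta>" "Suc (Suc h)"] P unfolding set_map set_upt interval image_comp by simp
qed

lemma g_vectors_rays:
  assumes "(\<alpha>, \<beta>) \<in> finite_type_pairs" "\<bar>s\<bar> = 1"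
  shows "g_vectors (transpose (rank2_matrix s \<alpha> \<beta>)) = rank2_fan.rays \<alpha> \<beta> (coxeter_number (\<alpha> * \<beta>)) s"
proof -
  let ?h = "coxeter_number (\<alpha> * \<beta>)"
  let ?v = "\<lambda>m. (s * alternating_rec \<beta> \<alpha> 0 1 m, s * alternating_rec \<beta> \<alpha> 1 0 m)"
  let ?M = "transpose (rank2_matrix s \<alpha> \<beta>)"
  interpret rank2_fan \<alpha> \<beta> ?h "alternating_rec \<beta> \<alpha> 0 1" "alternating_rec \<beta> \<alpha> 1 0"
    using finite_type_fan[OF assms(1)] by simp_all
  have M: "?M $ 1 $ 1 = 0" "?M $ 2 $ 2 = 0" "?M $ 1 $ 2 = - s * \<beta>" "?M $ 2 $ 1 = s * \<alpha>"
    by (simp_all add: transpose_def)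
  have sign: "?M $ 1 $ 2 * ?M $ 2 $ 1 \<le> 0"
    using nonneg mult_nonneg_nonneg[of "s * s" "\<alpha> * \<beta>"] unfolding M by (simp add: mult_ac)
  note range = g_walk_rays[OF assms]
  have ray_iff: "v \<in> rays s \<longleftrightarrow> (\<exists>m\<in>{..Suc ?h}. v $ 1 = fst (?v m) \<and> v $ 2 = snd (?v m))" for v
    by (auto simp: rays_def vec_eq_iff forall_2)
  have "{v :: int^2. (v $ 1, v $ 2) \<in> ?v ` {..Suc ?h}} = rays s"
    "{v :: int^2. (v $ 2, v $ 1) \<in> prod.swap ` ?v ` {..Suc ?h}} = rays s"
    by (simp_all add: set_eq_iff ray_iff image_iff bex_simps conj_commute)
  then show ?thesis
    unfolding g_vectors_walk[OF M(1,2) sign] M range by simp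
qed

section \<open>The theorem\<close>

theorem proposition9p4:
  fixes B :: "int^2^2" and R :: "real set"
  assumes "exchange_matrix B"
    and "finite_type2 B"
    and "underlying_ring R"
  shows "positive_basis_for R B (g_vectors (transpose B)) real_of_int_vec"
proof -
  obtain s \<alpha> \<beta> where B: "B = rank2_matrix s \<alpha> \<beta>" and s: "\<bar>s\<bar> = 1"
    and "0 \<le> \<alpha>" "0 \<le> \<beta>" "\<alpha> = 0 \<longleftrightarrow> \<beta> = 0"
    using exchange_matrix_rank2[OF assms(1)] by blast
  then have fin: "(\<alpha>, \<beta>) \<in> finite_type_pairs"
    using finite_type_rank2 assms(2) by blast
  show ?thesis
    unfolding B g_vectors_rays[OF fin s]
    by (rule rank2_fan.rays_positive_basis[OF finite_type_fan[OF fin] assms(3) s])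
qed

end
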